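(* Let $d\ge 1$, $k\ge 1$, $r\ge 2$ be integers and let $x=(x_1,\dots,x_d)$ be a vector of integers with $1\le x_i\le r-1$ for all $i$. Let $\mathcal{H}$ be a $(d,k,r,x)$-squid with $d(r+k)=|V(\mathcal{H})|$. Then $\gamma_p^k(\mathcal{H})=d$.
   Context: A (finite) hypergraph $\mathcal{H}=(V,E)$ is a finite set of vertices $V$ together with a set of edges $E$ that is a subset of the power set of $V$. It is $r$-uniform if every edge has exactly $r$ vertices. Two distinct vertices are adjacent (neighbors) if some edge contains both. It is connected if any two vertices are joined by a path of consecutively adjacent vertices. For $v\in V$, the closed neighborhood $N[v]$ consists of $v$ and all vertices adjacent to $v$; for $S\subseteq V$, $N[S]=\bigcup_{v\in S}N[v]$. A set $D\subseteq V$ colors vertices blue by the following process (vertices that are not blue are white). (1) Domination step: all vertices in $N[D]$ are colored blue. (2) Forcing step, applied repeatedly: given a blue vertex $v$, if there is a set of at most $k$ edges, each incident with $v$, that together contain all of $v$'s white neighbors, then these white neighbors turn blue. If iteratively applying these rules makes all vertices blue, then $D$ is a $k$-power dominating set of $\mathcal{H}$. The $k$-power domination number $\gamma_p^k(\mathcal{H})$ is the minimum cardinality of a $k$-power dominating set of $\mathcal{H}$. Definition of a $(d,k,r,x)$-squid: Its vertices are, for each $i\in\{1,\dots,d\}$, the strong vertices $s_{i,1},\dots,s_{i,r-x_i}$ and the weak vertices $w_{i,1},\dots,w_{i,k+x_i}$ (all distinct). The set of all vertices with first index $i$ is the $i$-th spine. Within each spine $i$ there are $k+1$ edges, each consisting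 of $r$ vertices of that spine and containing every strong vertex of that spine (hence exactly $x_i$ weak vertices of that spine), such that no proper subset of these $k+1$ edges covers all the weak vertices of the spine. In addition, any edges of size $r$ consisting only of strong vertices (possibly of different spines) may be added, so long as the resulting hypergraph is connected and $r$-uniform. Every edge of the squid is of one of these two types. *)

theory Defs
  imports Main
begin

definition hypergraph :: "'a set \<Rightarrow> 'a set set \<Rightarrow> bool" where
  "hypergraph V E \<longleftrightarrow> finite V \<and> E \<subseteq> Pow V"

definition uniform :: "nat \<Rightarrow> 'a set set \<Rightarrow> bool" where
  "uniform r E \<longleftrightarrow> (\<forall>e\<in>E. card e = r)"

definition adjacent :: "'a set set \<Rightarrow> 'a \<Rightarrow> 'a \<Rightarrow> bool" where
  "adjacent E u v \<longleftrightarrow> u \<noteq> v \<and> (\<exists>e\<in>E. u \<in> e \<and> v \<in> e)"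

definition connected_hypergraph :: "'a set \<Rightarrow> 'a set set \<Rightarrow> bool" where
  "connected_hypergraph V E \<longleftrightarrow> (\<forall>u\<in>V. \<forall>v\<in>V. (adjacent E)\<^sup>*\<^sup>* u v)"

definition neighbors :: "'a set set \<Rightarrow> 'a \<Rightarrow> 'a set" where
  "neighbors E v = {u. adjacent E v u}"

definition closed_nbhd :: "'a set set \<Rightarrow> 'a \<Rightarrow> 'a set" where
  "closed_nbhd E v = insert v (neighbors E v)"

definition closed_nbhd_set :: "'a set set \<Rightarrow> 'a set \<Rightarrow> 'a set" where
  "closed_nbhd_set E S = (\<Union>v\<in>S. closed_nbhd E v)"

text \<open>The sets of blue vertices that can occur after the domination step and finitely many
  single-vertex forcing steps, in any order.\<close>

inductive blue_set :: "nat \<Rightarrow> 'a set set \<Rightarrow> 'a set \<Rightarrow> 'a set \<Rightarrow> bool"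
  for k :: nat and E :: "'a set set" and D :: "'a set" where
  domination: "blue_set k E D (closed_nbhd_set E D)"
| forcing: "\<lbrakk>blue_set k E D B; v \<in> B; F \<subseteq> E; finite F; card F \<le> k; \<forall>e\<in>F. v \<in> e;
     neighbors E v - B \<subseteq> \<Union>F\<rbrakk> \<Longrightarrow> blue_set k E D (B \<union> (neighbors E v - B))"

definition power_dominating :: "nat \<Rightarrow> 'a set \<Rightarrow> 'a set set \<Rightarrow> 'a set \<Rightarrow> bool" where
  "power_dominating k V E D \<longleftrightarrow> D \<subseteq> V \<and> blue_set k E D V"

text \<open>For a hypergraph in the above sense the set below is finite and nonempty, since
  \<open>V\<close> itself is power dominating.\<close>

definition power_domination_number :: "nat \<Rightarrow> 'a set \<Rightarrow> 'a set set \<Rightarrow> nat" where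
  "power_domination_number k V E = Min (card ` {D. power_dominating k V E D})"

text \<open>Names \<open>s\<^sub>i\<^sub>,\<^sub>j\<close> and \<open>w\<^sub>i\<^sub>,\<^sub>j\<close> of squid vertices; a squid is a hypergraph whose vertices
  are bijectively named by these, so that all named vertices are distinct.\<close>

datatype squid_name = Strong nat nat | Weak nat nat

definition strong_names :: "nat \<Rightarrow> (nat \<Rightarrow> nat) \<Rightarrow> nat \<Rightarrow> squid_name set" where
  "strong_names r x i = {Strong i j | j. 1 \<le> j \<and> j \<le> r - x i}"

definition weak_names :: "nat \<Rightarrow> (nat \<Rightarrow> nat) \<Rightarrow> nat \<Rightarrow> squid_name set" where
  "weak_names k x i = {Weak i j | j. 1 \<le> j \<and> j \<le> k + x i}"

definition spine_names :: "nat \<Rightarrow> nat \<Rightarrow> (nat \<Rightarrow> nat) \<Rightarrow> nat \<Rightarrow> squid_name set" where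
  "spine_names k r x i = strong_names r x i \<union> weak_names k x i"

text \<open>In \<open>squid\<close>, \<open>\<phi>\<close> interprets the names, \<open>A i\<close> is the set of the \<open>k + 1\<close> edges within spine
  \<open>i\<close>, and \<open>X\<close> is the set of additional edges. That all of \<open>A i\<close> covers the weak vertices of
  spine \<open>i\<close> need not be required: by connectedness every vertex lies in an edge, and the
  edges in \<open>X\<close> contain no weak vertices. The vector \<open>(x\<^sub>1, \<dots>, x\<^sub>d)\<close> is given by the values
  of \<open>x\<close> on \<open>{1..d}\<close>; its other values are irrelevant.\<close>

definition squid ::
  "nat \<Rightarrow> nat \<Rightarrow> nat \<Rightarrow> (nat \<Rightarrow> nat) \<Rightarrow> 'a set \<Rightarrow> 'a set set \<Rightarrow> bool" where
  "squid d k r x V E \<longleftrightarrow>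
     hypergraph V E \<and> uniform r E \<and> connected_hypergraph V E \<and>
     (\<exists>\<phi> A X.
        bij_betw \<phi> (\<Union>i\<in>{1..d}. spine_names k r x i) V \<and>
        (\<forall>i\<in>{1..d}.
           card (A i) = k + 1 \<and>
           (\<forall>e\<in>A i. card e = r \<and> e \<subseteq> \<phi> ` spine_names k r x i \<and> \<phi> ` strong_names r x i \<subseteq> e) \<and>
           (\<forall>F. F \<subset> A i \<longrightarrow> \<not> \<phi> ` weak_names k x i \<subseteq> \<Union>F)) \<and>
        (\<forall>e\<in>X. card e = r \<and> e \<subseteq> (\<Union>i\<in>{1..d}. \<phi> ` strong_names r x i)) \<and>
        E = (\<Union>i\<in>{1..d}. A i) \<union> X)"

end

theory Submission
  imports Defs
begin

text \<open>One strong vertex per spine dominates everything, so \<open>d\<close> vertices suffice. Conversely, a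
  spine that misses \<open>D\<close> keeps all its weak vertices white: only a vertex of the same spine could
  force one of them, the first vertex to do so is strong and hence sees all weak vertices of the
  spine, and these cannot be covered by \<open>k\<close> edges. So \<open>D\<close> meets each of the \<open>d\<close> disjoint spines.\<close>

text \<open>The lower bound for a single spine: \<open>P\<close> is the spine, \<open>W\<close> its
  weak vertices and \<open>A\<close> its \<open>k + 1\<close> edges. Induction over the colouring
  process shows that no weak vertex ever turns blue, since forcing one would require covering all of
  \<open>W\<close> by at most \<open>k\<close> edges.\<close>

lemma blue_set_disjoint_weak:
  assumes "blue_set k E D B"
    and card_A: "card A = k + 1"
    and A_sub: "\<And>e. e \<in> A \<Longrightarrow> e \<subseteq> P"
    and strong_sub: "\<And>e. e \<in> A \<Longrightarrow> P - W \<subseteq> e"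
    and weak_edge: "\<And>e. e \<in> E \<Longrightarrow> e \<inter> W \<noteq> {} \<Longrightarrow> e \<in> A"
    and "A \<subseteq> E" and "W \<subseteq> P" and W_cover: "W \<subseteq> \<Union>A"
    and minimal: "\<And>F. F \<subset> A \<Longrightarrow> \<not> W \<subseteq> \<Union>F"
    and "D \<inter> P = {}"
  shows "B \<inter> W = {}"
proof -
  have nbr_in_P: "v \<in> P" if "w \<in> neighbors E v" "w \<in> W" for v w
    using that weak_edge A_sub unfolding neighbors_def adjacent_def by blast
  show ?thesis
    using \<open>blue_set k E D B\<close>
  proof induction
    case domination
    show ?case
      using nbr_in_P \<open>D \<inter> P = {}\<close> \<open>W \<subseteq> P\<close>
      unfolding closed_nbhd_set_def closed_nbhd_def by blast
  next
    case (forcing B v F)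
    have "neighbors E v \<inter> W = {}"
    proof (rule ccontr)
      assume "neighbors E v \<inter> W \<noteq> {}"
      \<comment> \<open>A neighbour of a weak vertex lies in the spine; \<open>v\<close> is blue, so
        by the induction hypothesis it is not weak.\<close>
      then have v: "v \<in> P - W"
        using nbr_in_P forcing by blast
      have "W \<subseteq> neighbors E v"
      proof
        fix w assume "w \<in> W"
        then obtain e where "e \<in> A" "w \<in> e"
          using W_cover by blast
        then show "w \<in> neighbors E v"
          using v strong_sub \<open>A \<subseteq> E\<close> \<open>w \<in> W\<close> unfolding neighbors_def adjacent_def by blast
      qed
      \<comment> \<open>By the induction hypothesis all of \<open>W\<close> is still white, so all
        of it is among the white neighbours that \<open>F\<close> must contain.\<close>
      then have "W \<subseteq> \<Union>F"
        using forcing by blast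
      \<comment> \<open>Edges outside \<open>A\<close> contain no weak vertex and contribute nothing
        to the cover.\<close>
      then have "W \<subseteq> \<Union>(F \<inter> A)"
        using weak_edge \<open>F \<subseteq> E\<close> by blast
      \<comment> \<open>\<open>A \<subseteq> F\<close> would give
        \<open>k + 1 \<le> k\<close>.\<close>
      moreover have "F \<inter> A \<subset> A"
        using card_A \<open>card F \<le> k\<close> \<open>finite F\<close> card_mono[of F A] by auto
      ultimately show False
        using minimal by blast
    qed
    then show ?case
      using forcing by blast
  qed
qed

text \<open>Choosing a point of \<open>D\<close> in each \<open>P i\<close> is injective by
  disjointness. This turns the bound for single spines into the bound \<open>d\<close>.\<close>

lemma card_ge_if_meets_disjoint:
  assumes "finite D" and "finite I"
    and "\<And>i. i \<in> I \<Longrightarrow> D \<inter> P i \<noteq> {}"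
    and "\<And>i j. i \<in> I \<Longrightarrow> j \<in> I \<Longrightarrow> i \<noteq> j \<Longrightarrow> P i \<inter> P j = {}"
  shows "card I \<le> card D"
proof -
  have "\<forall>i\<in>I. \<exists>v. v \<in> D \<inter> P i"
    using assms(3) by blast
  then obtain f where f: "\<And>i. i \<in> I \<Longrightarrow> f i \<in> D \<inter> P i"
    unfolding bchoice_iff by blast
  have "inj_on f I"
    using f assms(4) by (intro inj_onI) (metis IntD2 disjoint_iff)
  moreover have "f ` I \<subseteq> D"
    using f by blast
  ultimately show ?thesis
    using \<open>finite D\<close> by (metis card_inj_on_le)
qed

text \<open>The first step of a path from \<open>u\<close> to \<open>v\<close> takes place inside an
  edge through \<open>u\<close>. This is how connectedness yields that the weak vertices are
  covered.\<close>

lemma connected_hypergraph_vertex_in_edge: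
  assumes "connected_hypergraph V E" and "u \<in> V" and "v \<in> V" and "u \<noteq> v"
  obtains e where "e \<in> E" and "u \<in> e"
proof -
  have "(adjacent E)\<^sup>*\<^sup>* u v"
    using assms unfolding connected_hypergraph_def by blast
  then show thesis
    using \<open>u \<noteq> v\<close> that by (cases rule: converse_rtranclpE) (auto simp: adjacent_def)
qed

theorem proposition4p1:
  fixes d k r :: nat and x :: "nat \<Rightarrow> nat" and V :: "'a set" and E :: "'a set set"
  assumes "d \<ge> 1" and "k \<ge> 1" and "r \<ge> 2"
    and "\<forall>i\<in>{1..d}. 1 \<le> x i \<and> x i \<le> r - 1"
    and "squid d k r x V E"
    and "d * (r + k) = card V"
  shows "power_domination_number k V E = d"
proof -
  obtain \<phi> A X where
    fin: "finite V" and EV: "E \<subseteq> Pow V" and conn: "connected_hypergraph V E"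
    and bij: "bij_betw \<phi> (\<Union>i\<in>{1..d}. spine_names k r x i) V"
    and card_A: "\<And>i. i \<in> {1..d} \<Longrightarrow> card (A i) = k + 1"
    and A_sub: "\<And>i e. i \<in> {1..d} \<Longrightarrow> e \<in> A i \<Longrightarrow> e \<subseteq> \<phi> ` spine_names k r x i"
    and strong_sub: "\<And>i e. i \<in> {1..d} \<Longrightarrow> e \<in> A i \<Longrightarrow> \<phi> ` strong_names r x i \<subseteq> e"
    and minimal: "\<And>i F. i \<in> {1..d} \<Longrightarrow> F \<subset> A i \<Longrightarrow> \<not> \<phi> ` weak_names k x i \<subseteq> \<Union>F"
    and X_sub: "\<And>e. e \<in> X \<Longrightarrow> e \<subseteq> (\<Union>i\<in>{1..d}. \<phi> ` strong_names r x i)"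
    and E: "E = (\<Union>i\<in>{1..d}. A i) \<union> X"
    using \<open>squid d k r x V E\<close> unfolding squid_def hypergraph_def by (elim exE conjE) simp
  define S where "S i = \<phi> ` strong_names r x i" for i
  define W where "W i = \<phi> ` weak_names k x i" for i
  define P where "P i = \<phi> ` spine_names k r x i" for i
  have P: "P i = S i \<union> W i" for i
    unfolding P_def S_def W_def spine_names_def by blast
  have inj: "inj_on \<phi> (\<Union>i\<in>{1..d}. spine_names k r x i)" and V: "V = (\<Union>i\<in>{1..d}. P i)"
    using bij unfolding bij_betw_def P_def by auto
  have P_disj: "P i \<inter> P j = {}" if "i \<in> {1..d}" "j \<in> {1..d}" "i \<noteq> j" for i j
  proof -
    have "spine_names k r x i \<inter> spine_names k r x j = {}"
      using that unfolding spine_names_def strong_names_def weak_names_def by auto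
    moreover have "\<phi> ` (spine_names k r x i \<inter> spine_names k r x j) = P i \<inter> P j"
      unfolding P_def using that by (intro inj_on_image_Int[OF inj]) auto
    ultimately show ?thesis
      by simp
  qed
  have SW_disj: "S i \<inter> W i = {}" if "i \<in> {1..d}" for i
  proof -
    have "strong_names r x i \<inter> weak_names k x i = {}"
      unfolding strong_names_def weak_names_def by auto
    moreover have "\<phi> ` (strong_names r x i \<inter> weak_names k x i) = S i \<inter> W i"
      unfolding S_def W_def using that
      by (intro inj_on_image_Int[OF inj]) (auto simp: spine_names_def)
    ultimately show ?thesis
      by simp
  qed
  define s where "s i = \<phi> (Strong i 1)" for i
  \<comment> \<open>The index 1 is admissible: \<open>x i \<le> r - 1\<close> and
    \<open>r \<ge> 2\<close> leave \<open>r - x i \<ge> 1\<close>.\<close>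
  have s: "s i \<in> S i" if "i \<in> {1..d}" for i
    using that assms(3,4) unfolding s_def S_def strong_names_def by fastforce
  have W_ne: "W i \<noteq> {}" for i
    using \<open>k \<ge> 1\<close> unfolding W_def weak_names_def by auto
  \<comment> \<open>Additional edges have only strong vertices, and the edges of another spine stay
    inside that disjoint spine.\<close>
  have weak_edge: "e \<in> A i" if "i \<in> {1..d}" "e \<in> E" "e \<inter> W i \<noteq> {}" for i e
  proof -
    have "\<exists>w. w \<in> e \<and> w \<in> W i \<and> w \<in> P i"
      using that(3) P by blast
    then obtain w where w: "w \<in> e" "w \<in> W i" "w \<in> P i"
      by blast
    have False if "e \<in> X"
    proof -
      obtain j where "j \<in> {1..d}" "w \<in> S j"
        using X_sub[OF \<open>e \<in> X\<close>] w(1) unfolding S_def by blast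
      then show False
        using w P_disj[OF \<open>i \<in> {1..d}\<close>] SW_disj P by blast
    qed
    then obtain j where j: "j \<in> {1..d}" "e \<in> A j"
      using \<open>e \<in> E\<close> E by blast
    then have "w \<in> P j"
      using A_sub w(1) unfolding P_def by blast
    then show ?thesis
      using w j P_disj[OF \<open>i \<in> {1..d}\<close> \<open>j \<in> {1..d}\<close>] by blast
  qed
  have W_cover: "W i \<subseteq> \<Union>(A i)" if i: "i \<in> {1..d}" for i
  proof
    fix w assume w: "w \<in> W i"
    \<comment> \<open>The strong vertex \<open>s i\<close> serves as the second vertex that makes
      connectedness give an edge through \<open>w\<close>.\<close>
    have "w \<in> V" "s i \<in> V" "w \<noteq> s i"
      using w i s[OF i] P V SW_disj[OF i] by blast+
    then obtain e where "e \<in> E" "w \<in> e"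
      using connected_hypergraph_vertex_in_edge[OF conn] by blast
    then show "w \<in> \<Union>(A i)"
      using weak_edge[OF i] w by blast
  qed

  have upper: "power_dominating k V E (s ` {1..d})"
  proof -
    have "P i \<subseteq> closed_nbhd E (s i)" if i: "i \<in> {1..d}" for i
    proof
      fix v assume "v \<in> P i"
      \<comment> \<open>Every edge of \<open>A i\<close> contains \<open>s i\<close> and all strong
        vertices of the spine, so any one edge serves a strong \<open>v\<close>; a weak
        \<open>v\<close> lies in some edge by \<open>W_cover\<close>.\<close>
      have "A i \<noteq> {}"
        using card_A[OF i] by auto
      then obtain e where "e \<in> A i" "v \<in> e"
        using \<open>v \<in> P i\<close> W_cover[OF i] strong_sub[OF i] unfolding P S_def by blast
      moreover from this have "s i \<in> e" "e \<in> E"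
        using strong_sub[OF i] s[OF i] i E unfolding S_def by blast+
      ultimately show "v \<in> closed_nbhd E (s i)"
        unfolding closed_nbhd_def neighbors_def adjacent_def by blast
    qed
    then have "V \<subseteq> closed_nbhd_set E (s ` {1..d})"
      unfolding V closed_nbhd_set_def by blast
    moreover have "s ` {1..d} \<subseteq> V"
      using s P V by blast
    \<comment> \<open>With both inclusions the domination step alone colours exactly
      \<open>V\<close>; no forcing occurs.\<close>
    moreover from this have "closed_nbhd_set E (s ` {1..d}) \<subseteq> V"
      using EV unfolding closed_nbhd_set_def closed_nbhd_def neighbors_def adjacent_def by blast
    ultimately show ?thesis
      unfolding power_dominating_def by (metis blue_set.domination subset_antisym)
  qed
  have "inj_on s {1..d}"
  proof (rule inj_onI)
    fix i j assume "i \<in> {1..d}" "j \<in> {1..d}" "s i = s j"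
    then show "i = j"
      using s[of i] s[of j] P_disj[of i j] P by auto
  qed
  then have card_s: "card (s ` {1..d}) = d"
    by (simp add: card_image)

  have lower: "d \<le> card D" if D: "power_dominating k V E D" for D
  proof -
    have "D \<inter> P i \<noteq> {}" if i: "i \<in> {1..d}" for i
    proof
      assume "D \<inter> P i = {}"
      then have "V \<inter> W i = {}"
      \<comment> \<open>The rotation puts the premise on \<open>D\<close> first, where the chained
        fact discharges it; the blue set considered is the final one, \<open>V\<close>.\<close>
      proof (rule blue_set_disjoint_weak[rotated -1, where A = "A i"])
        show "blue_set k E D V"
          using D unfolding power_dominating_def by blast
        show "P i - W i \<subseteq> e" if "e \<in> A i" for e
          using strong_sub[OF i that] unfolding P S_def by blast
        show "A i \<subseteq> E"
          using E i by blast
        show "e \<subseteq> P i" if "e \<in> A i" for e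
          using A_sub[OF i that] unfolding P_def .
        show "\<not> W i \<subseteq> \<Union>F" if "F \<subset> A i" for F
          using minimal[OF i that] unfolding W_def .
      qed (use card_A[OF i] weak_edge[OF i] W_cover[OF i] P in auto)
      then show False
        using W_ne[of i] P V i by blast
    qed
    moreover have "finite D"
      using D fin finite_subset unfolding power_dominating_def by blast
    ultimately show ?thesis
      using card_ge_if_meets_disjoint[of D "{1..d}" P] P_disj by simp
  qed

  \<comment> \<open>\<open>Min\<close> is only meaningful on a finite set; here all candidates are
    subsets of \<open>V\<close>.\<close>
  have "finite {D. power_dominating k V E D}"
    using fin by (rule finite_subset[rotated, OF finite_Pow_iff[THEN iffD2]])
      (auto simp: power_dominating_def)
  then show ?thesis
    unfolding power_domination_number_def
    using upper card_s lower by (intro Min_eqI) (auto intro: rev_image_eqI)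
qed

end
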